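(* Let $(c_n)_{n\ge0}$ be a sequence of nonzero numbers with $c_0=1$, let $\omega$ be an umbra with $\omega^n\simeq n!/c_n$ (nonzero moments), and let $\gamma,\alpha,\sigma,\rho$ be umbrae. Let $\gamma',\alpha'$ be umbrae such that the matrix product of the exponential Riordan arrays satisfies $(\gamma,\alpha)(\sigma,\rho)=(\gamma',\alpha')$. Then \[ {}_\omega(\gamma,\alpha)\,{}_\omega(\sigma,\rho)={}_\omega(\gamma',\alpha'), \] and, if $(\gamma,\alpha)^{-1}=(\gamma'',\alpha'')$ as exponential Riordan arrays, then \[ \big[{}_\omega(\gamma,\alpha)\big]^{-1}={}_\omega(\gamma'',\alpha'')={}_\omega(\mathfrak L_{\gamma,\alpha},\mathfrak L_{\alpha}). \]
   Context: Classical umbral calculus: $R=\mathbb{C}[x]$, $A$ a saturated alphabet of umbrae, $E:R[A]\to R$ linear with $E[1]=1$ and $E[\alpha^i\beta^j\cdots]=E[\alpha^i]E[\beta^j]\cdots$ for distinct umbrae; $p\simeq q$ means $E[p]=E[q]$, $p\equiv q$ means $p^n\simeq q^n$ for all $n$. $f_\alpha(t)=\sum_n E[\alpha^n]t^n/n!$. For $x$ an integer (possibly negative), $x.\alpha$ is an umbra with $(x.\alpha)^n\simeq n![t^n]f_\alpha(t)^x$. For umbrae $\sigma,\alpha$, $\mathfrak K_{\sigma,\alpha}$ is an umbra with $\mathfrak K_{\sigma,\alpha}^0=1$, $\mathfrak K_{\sigma,\alpha}^n\simeq\sigma(\sigma+(-n).\alpha)^{n-1}$ for $n\ge1$ ($(-n).\alpha$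 uncorrelated with $\sigma$); $\mathfrak L_{\sigma,\alpha}:=(-1).\mathfrak K_{\sigma,\alpha}$ and $\mathfrak L_\alpha:=\mathfrak L_{\alpha,\alpha}$. The $\omega$-Riordan array ${}_\omega(\gamma,\alpha)$ is the lower triangular matrix with entries ${}_\omega(\gamma,\alpha)_{n,k}=E\!\left[\frac{c_n}{c_k}\frac{(\gamma+k.\alpha)^{n-k}}{(n-k)!}\right]$ ($n\ge k\ge0$, $\gamma$ and $k.\alpha$ uncorrelated); the exponential Riordan array $(\gamma,\alpha)$ is the case $c_n=n!$, i.e. $(\gamma,\alpha)_{n,k}=E\big[\binom{n}{k}(\gamma+k.\alpha)^{n-k}\big]$. Exponential Riordan arrays form a group under matrix multiplication, so products and inverses of such arrays are again of the form $(\gamma',\alpha')$. *)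

theory Defs
  imports
    Complex_Main
    "HOL-Library.Poly_Mapping"
    "HOL-Computational_Algebra.Polynomial"
    "HOL-Computational_Algebra.Formal_Power_Series"
begin

(* The alphabet A is the whole type 'a; the umbral polynomials R[A] over R = C[x] are
   finitely supported maps from monomials (exponent maps) to coefficients. *)
type_synonym 'a umbral_poly = "('a \<Rightarrow>\<^sub>0 nat) \<Rightarrow>\<^sub>0 complex poly"

definition umbra :: "'a \<Rightarrow> 'a umbral_poly" where
  "umbra \<alpha> = Poly_Mapping.single (Poly_Mapping.single \<alpha> 1) 1"

definition scal :: "complex poly \<Rightarrow> 'a umbral_poly" where
  "scal r = Poly_Mapping.single 0 r"

text \<open>Saturation: every sequence in \<open>R\<close> starting with 1 is the moment sequence of infinitely
  many distinct umbrae. Distinct umbrae are uncorrelated.\<close>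

locale saturated_umbral_calculus =
  fixes E :: "'a umbral_poly \<Rightarrow> complex poly"
  assumes E_add: "E (p + q) = E p + E q"
    and E_scal: "E (scal r * p) = r * E p"
    and E_one: "E 1 = 1"
    and E_uncorrelated:
      "finite S \<Longrightarrow> E (\<Prod>\<alpha>\<in>S. umbra \<alpha> ^ e \<alpha>) = (\<Prod>\<alpha>\<in>S. E (umbra \<alpha> ^ e \<alpha>))"
    and saturated: "a 0 = 1 \<Longrightarrow> infinite {\<alpha>. \<forall>n. E (umbra \<alpha> ^ n) = a n}"

definition umbral_gf :: "('a umbral_poly \<Rightarrow> complex poly) \<Rightarrow> 'a \<Rightarrow> complex poly fps" where
  "umbral_gf E \<alpha> = Abs_fps (\<lambda>n. smult (1 / fact n) (E (umbra \<alpha> ^ n)))"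

text \<open>Integer powers of a power series with constant term 1. The type of complex polynomials is
  not in the class required by the library's \<open>inverse\<close> on power series, hence
  \<open>fps_right_inverse\<close>, whose second argument is the inverse of the constant term.\<close>

definition fps_int_power :: "complex poly fps \<Rightarrow> int \<Rightarrow> complex poly fps" where
  "fps_int_power f x =
     (if x \<ge> 0 then f ^ nat x else fps_right_inverse f 1 ^ nat (- x))"

text \<open>An umbra \<open>x.\<alpha>\<close> that is uncorrelated with all umbrae in the (finite) set \<open>S\<close>.\<close>

definition dot_umbra ::
  "('a umbral_poly \<Rightarrow> complex poly) \<Rightarrow> 'a set \<Rightarrow> int \<Rightarrow> 'a \<Rightarrow> 'a" where
  "dot_umbra E S x \<alpha> = (SOME \<beta>. \<beta> \<notin> S \<and>
     (\<forall>n. E (umbra \<beta> ^ n) = smult (fact n) (fps_nth (fps_int_power (umbral_gf E \<alpha>) x) n)))"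

definition K_umbra :: "('a umbral_poly \<Rightarrow> complex poly) \<Rightarrow> 'a \<Rightarrow> 'a \<Rightarrow> 'a" where
  "K_umbra E \<sigma> \<alpha> = (SOME \<kappa>. E (umbra \<kappa> ^ 0) = 1 \<and>
     (\<forall>n\<ge>1. E (umbra \<kappa> ^ n) =
       E (umbra \<sigma> * (umbra \<sigma> + umbra (dot_umbra E {\<sigma>} (- int n) \<alpha>)) ^ (n - 1))))"

definition L_umbra :: "('a umbral_poly \<Rightarrow> complex poly) \<Rightarrow> 'a \<Rightarrow> 'a \<Rightarrow> 'a" where
  "L_umbra E \<sigma> \<alpha> = dot_umbra E {} (- 1) (K_umbra E \<sigma> \<alpha>)"

definition omega_riordan ::
  "('a umbral_poly \<Rightarrow> complex poly) \<Rightarrow> (nat \<Rightarrow> complex) \<Rightarrow> 'a \<Rightarrow> 'a \<Rightarrow>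
     nat \<Rightarrow> nat \<Rightarrow> complex poly" where
  "omega_riordan E c \<gamma> \<alpha> n k =
     (if k \<le> n
      then E (scal [:c n / c k / fact (n - k):] *
              (umbra \<gamma> + umbra (dot_umbra E {\<gamma>} (int k) \<alpha>)) ^ (n - k))
      else 0)"

definition exp_riordan ::
  "('a umbral_poly \<Rightarrow> complex poly) \<Rightarrow> 'a \<Rightarrow> 'a \<Rightarrow> nat \<Rightarrow> nat \<Rightarrow> complex poly" where
  "exp_riordan E \<gamma> \<alpha> = omega_riordan E fact \<gamma> \<alpha>"

definition lower_triangular :: "(nat \<Rightarrow> nat \<Rightarrow> 'b::zero) \<Rightarrow> bool" where
  "lower_triangular M \<longleftrightarrow> (\<forall>n k. n < k \<longrightarrow> M n k = 0)"

text \<open>Product of infinite matrices whose left factor is lower triangular.\<close>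

definition lt_mult ::
  "(nat \<Rightarrow> nat \<Rightarrow> 'b::semiring_0) \<Rightarrow> (nat \<Rightarrow> nat \<Rightarrow> 'b) \<Rightarrow> nat \<Rightarrow> nat \<Rightarrow> 'b" where
  "lt_mult M N n k = (\<Sum>j\<le>n. M n j * N j k)"

definition lt_one :: "nat \<Rightarrow> nat \<Rightarrow> 'b::zero_neq_one" where
  "lt_one n k = (if n = k then 1 else 0)"

definition is_lt_inverse ::
  "(nat \<Rightarrow> nat \<Rightarrow> 'b::semiring_1) \<Rightarrow> (nat \<Rightarrow> nat \<Rightarrow> 'b) \<Rightarrow> bool" where
  "is_lt_inverse M N \<longleftrightarrow> lower_triangular M \<and> lower_triangular N \<and>
     lt_mult M N = lt_one \<and> lt_mult N M = lt_one"

lemma lower_triangular_omega_riordan: "lower_triangular (omega_riordan E c \<gamma> \<alpha>)"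
  by (simp add: lower_triangular_def omega_riordan_def)

lemma exp_riordan_binomial:
  assumes "k \<le> n"
  shows "exp_riordan E \<gamma> \<alpha> n k =
    E (of_nat (n choose k) * (umbra \<gamma> + umbra (dot_umbra E {\<gamma>} (int k) \<alpha>)) ^ (n - k))"
proof -
  have "scal [:fact n / fact k / fact (n - k):] = (of_nat (n choose k) :: 'a umbral_poly)"
    using assms
    by (simp only: scal_def binomial_fact[OF assms] of_nat_poly divide_divide_eq_left
        flip: single_of_nat)
  then show ?thesis
    using assms by (simp add: exp_riordan_def omega_riordan_def)
qed

lemma (in saturated_umbral_calculus) moments_exist:
  assumes "finite S" and "a 0 = 1"
  shows "\<exists>\<beta>. \<beta> \<notin> S \<and> (\<forall>n. E (umbra \<beta> ^ n) = a n)"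
  using saturated[of a, OF assms(2)] assms(1)
  by (metis (mono_tags, lifting) finite_subset mem_Collect_eq subsetI)

lemma (in saturated_umbral_calculus) fps_int_power_umbral_gf_0:
  "fps_nth (fps_int_power (umbral_gf E \<alpha>) x) 0 = 1"
  by (simp add: fps_int_power_def umbral_gf_def E_one fps_power_zeroth flip: one_pCons)

lemma (in saturated_umbral_calculus) dot_umbra:
  assumes "finite S"
  shows "dot_umbra E S x \<alpha> \<notin> S"
    and "E (umbra (dot_umbra E S x \<alpha>) ^ n) =
      smult (fact n) (fps_nth (fps_int_power (umbral_gf E \<alpha>) x) n)"
proof -
  have "\<exists>\<beta>. \<beta> \<notin> S \<and> (\<forall>n. E (umbra \<beta> ^ n) =
      smult (fact n) (fps_nth (fps_int_power (umbral_gf E \<alpha>) x) n))"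
    by (rule moments_exist[OF assms]) (simp add: fps_int_power_umbral_gf_0)
  from someI_ex[OF this]
  show "dot_umbra E S x \<alpha> \<notin> S"
    and "E (umbra (dot_umbra E S x \<alpha>) ^ n) =
      smult (fact n) (fps_nth (fps_int_power (umbral_gf E \<alpha>) x) n)"
    by (simp_all add: dot_umbra_def)
qed

lemma (in saturated_umbral_calculus) K_umbra:
  assumes "n \<ge> 1"
  shows "E (umbra (K_umbra E \<sigma> \<alpha>) ^ n) =
    E (umbra \<sigma> * (umbra \<sigma> + umbra (dot_umbra E {\<sigma>} (- int n) \<alpha>)) ^ (n - 1))"
proof -
  let ?m = "\<lambda>n. E (umbra \<sigma> * (umbra \<sigma> + umbra (dot_umbra E {\<sigma>} (- int n) \<alpha>)) ^ (n - 1))"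
  obtain \<kappa> where "\<forall>n. E (umbra \<kappa> ^ n) = (if n = 0 then 1 else ?m n)"
    using moments_exist[of "{}" "\<lambda>n. if n = 0 then 1 else ?m n"] by auto
  then have "\<exists>\<kappa>. E (umbra \<kappa> ^ 0) = 1 \<and> (\<forall>n\<ge>1. E (umbra \<kappa> ^ n) = ?m n)"
    by (intro exI[of _ \<kappa>]) (auto simp: E_one)
  from someI_ex[OF this] assms show ?thesis
    unfolding K_umbra_def by blast
qed

end

theory Submission
  imports Defs
begin

text \<open>In terms of generating functions \<open>g = f\<^sub>\<gamma>\<close>, \<open>a = f\<^sub>\<alpha>\<close>, the \<open>(n, k)\<close> entry of the
  \<open>\<omega>\<close>-Riordan array is \<open>c n / c k\<close> times the coefficient of \<open>t^n\<close> in \<open>g F^k\<close>, where \<open>F = t a\<close>.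
  Hence all \<open>\<omega>\<close>-Riordan arrays with the same umbrae are diagonally conjugate, which transports
  products and inverses. If \<open>(\<gamma>, \<alpha>)\<close> has inverse \<open>(\<gamma>'', \<alpha>'')\<close>, comparing columns 0 and 1 of the
  product with the identity gives \<open>g (g'' \<circ> F) = 1\<close> and \<open>a (a'' \<circ> F) = 1\<close>, so \<open>g\<close> and \<open>a\<close> are
  \<open>(1 / g'') \<circ> F\<close> and \<open>(1 / a'') \<circ> F\<close>. The moments of \<open>\<KK>\<^bsub>\<sigma>,\<alpha>\<^esub>\<close> are the coefficients that
  Lagrange inversion assigns to the series \<open>k\<close> with \<open>f\<^sub>\<sigma> = k \<circ> F\<close>, so that \<open>\<LL>\<^bsub>\<gamma>,\<alpha>\<^esub>\<close> and
  \<open>\<LL>\<^sub>\<alpha>\<close> have the generating functions \<open>g''\<close> and \<open>a''\<close>.\<close>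

unbundle fps_syntax

section \<open>Composition of power series and Lagrange inversion\<close>

lemma left_inverse_eq_right_inverse:
  fixes x y z :: "'b::monoid_mult"
  assumes "x * y = 1" and "y * z = 1"
  shows "x = z"
  using arg_cong[OF assms(2), of "(*) x"] assms(1) by (simp flip: mult.assoc)

text \<open>This turns a row of a Riordan array applied to the coefficients of \<open>f\<close> into
  composition with \<open>F\<close>.\<close>

lemma fps_compose_mult_nth:
  fixes f F G :: "'b::idom fps"
  assumes "F $ 0 = 0"
  shows "((f oo F) * G) $ n = (\<Sum>m\<le>n. f $ m * (F ^ m * G) $ n)"
proof -
  have "((f oo F) * G) $ n = (\<Sum>i=0..n. (\<Sum>m=0..i. f $ m * (F ^ m) $ i) * G $ (n - i))"
    by (simp add: fps_mult_nth fps_compose_nth)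
  \<comment> \<open>\<open>F ^ m\<close> starts at order m or later, so the terms with i < m vanish
    and both ranges become independent.\<close>
  also have "\<dots> = (\<Sum>i=0..n. (\<Sum>m=0..n. f $ m * (F ^ m) $ i) * G $ (n - i))"
    by (intro sum.cong refl arg_cong2[where f = "(*)"] sum.mono_neutral_left)
      (auto simp: startsby_zero_power_prefix[OF assms])
  also have "\<dots> = (\<Sum>m=0..n. \<Sum>i=0..n. f $ m * (F ^ m) $ i * G $ (n - i))"
    by (subst sum.swap) (simp add: sum_distrib_right)
  also have "\<dots> = (\<Sum>m\<le>n. f $ m * (F ^ m * G) $ n)"
    by (simp add: fps_mult_nth sum_distrib_left mult.assoc atMost_atLeast0)
  finally show ?thesis .
qed

text \<open>With F = X a and b = 1/a, the coefficient is the residue of F^(m-n) F'. For m + 1 < n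
  this is the derivative of F^(m-n+1)/(m-n+1), hence has residue 0; for m + 1 = n it is F'/F, with
  residue 1. The proof stays within power series.\<close>

lemma fps_lagrange_kernel:
  fixes a b :: "'b::{idom, semiring_char_0} fps"
  assumes ab: "a * b = 1" and "m < n"
  shows "((fps_X * a) ^ m * (fps_deriv (fps_X * a) * b ^ n)) $ (n - 1) = (if Suc m = n then 1 else 0)"
proof -
  \<comment> \<open>Cancelling a^m against b^m leaves the coefficient of X^p in b^p + X a'
    b^(p+1).\<close>
  define p where "p = n - Suc m"
  have n: "n = Suc (m + p)"
    using assms(2) by (simp add: p_def)
  have abm: "a ^ m * b ^ m = 1"
    by (simp add: ab flip: power_mult_distrib)
  have "(fps_X * a) ^ m * (fps_deriv (fps_X * a) * b ^ n) =
      fps_X ^ m * ((a ^ m * b ^ m) * ((a * b) * b ^ p + fps_X * (fps_deriv a * b ^ Suc p)))"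
    by (simp add: n power_mult_distrib power_add algebra_simps)
  also have "\<dots> = fps_X ^ m * (b ^ p + fps_X * (fps_deriv a * b ^ Suc p))"
    by (simp only: abm ab mult_1)
  finally have *: "((fps_X * a) ^ m * (fps_deriv (fps_X * a) * b ^ n)) $ (n - 1) =
      (b ^ p + fps_X * (fps_deriv a * b ^ Suc p)) $ p"
    by (simp add: n fps_X_power_mult_nth)
  show ?thesis
  proof (cases p)
    case 0
    then show ?thesis
      unfolding * by (simp add: n)
  next
    case (Suc q)
    \<comment> \<open>Differentiating a b = 1 gives p a' b^(p+1) = -(b^p)', so the two contributions
      cancel. The factor p is kept to the end, as coefficients need not be divisible by it.\<close>
    have "fps_deriv a * b + a * fps_deriv b = 0"
      using arg_cong[OF ab, of fps_deriv] by (simp add: algebra_simps)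
    then have ab': "fps_deriv a * b = - (a * fps_deriv b)"
      by (simp add: eq_neg_iff_add_eq_0)
    have "fps_deriv a * b ^ Suc p = (fps_deriv a * b) * b * b ^ q"
      by (simp add: Suc algebra_simps)
    also have "\<dots> = - ((a * b) * fps_deriv b * b ^ q)"
      unfolding ab' by (simp add: algebra_simps)
    finally have "fps_deriv a * b ^ Suc p = - (fps_deriv b * b ^ q)"
      by (simp only: ab mult_1)
    moreover have "fps_deriv (b ^ p) = of_nat p * (fps_deriv b * b ^ q)"
      using fps_deriv_power[of b p] by (simp only: Suc diff_Suc_1 fps_of_nat mult.assoc)
    ultimately have "of_nat p * (fps_deriv a * b ^ Suc p) = - fps_deriv (b ^ p)"
      by (simp only: mult_minus_right)
    then have "(of_nat p * (fps_deriv a * b ^ Suc p)) $ q = (- fps_deriv (b ^ p)) $ q"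
      by (rule arg_cong)
    then have "of_nat p * ((fps_deriv a * b ^ Suc p) $ q) = - (of_nat p * (b ^ p) $ p)"
      by (simp add: Suc fps_mult_of_nat_nth del: power_Suc of_nat_Suc)
    then have "of_nat p * ((b ^ p) $ p + (fps_deriv a * b ^ Suc p) $ q) = 0"
      by (simp add: distrib_left del: power_Suc)
    then have "(b ^ p) $ p + (fps_deriv a * b ^ Suc p) $ q = 0"
      unfolding mult_eq_0_iff of_nat_eq_0_iff by (simp add: Suc)
    then show ?thesis
      unfolding * using Suc by (simp add: n del: power_Suc)
  qed
qed

text \<open>By the chain rule the left side is a combination of the kernel coefficients, of which
  only m = n - 1 survives, weighted by the coefficient of X^(n-1) in k'.\<close>

lemma fps_lagrange_inversion:
  fixes a b k :: "'b::{idom, semiring_char_0} fps"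
  assumes "a * b = 1" and "n \<ge> 1"
  shows "(fps_deriv (k oo (fps_X * a)) * b ^ n) $ (n - 1) = of_nat n * k $ n"
proof -
  let ?F = "fps_X * a"
  have "fps_deriv (k oo ?F) * b ^ n = (fps_deriv k oo ?F) * (fps_deriv ?F * b ^ n)"
    by (simp add: fps_compose_deriv mult.assoc)
  then have "(fps_deriv (k oo ?F) * b ^ n) $ (n - 1) =
      (\<Sum>m\<le>n - 1. fps_deriv k $ m * (?F ^ m * (fps_deriv ?F * b ^ n)) $ (n - 1))"
    by (simp only: fps_compose_mult_nth[of ?F] fps_X_mult_nth if_True simp_thms)
  also have "\<dots> = (\<Sum>m\<le>n - 1. if m = n - 1 then fps_deriv k $ m else 0)"
    using assms by (intro sum.cong refl, subst fps_lagrange_kernel) auto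
  also have "\<dots> = of_nat n * k $ n"
    using assms(2) by simp
  finally show ?thesis .
qed

section \<open>Binomial convolution and diagonal conjugation\<close>

lemma smult_sum_right: "smult r (\<Sum>i\<in>I. p i) = (\<Sum>i\<in>I. smult r (p i))"
  by (induction I rule: infinite_finite_induct) (simp_all add: smult_add_right)

text \<open>Moments of a sum of uncorrelated umbrae thus correspond to the product of generating
  functions.\<close>

lemma sum_binomial_fact_convolution:
  fixes f g :: "complex poly fps"
  shows "(\<Sum>i\<le>m. of_nat (m choose i) * (smult (fact i) (f $ i) * smult (fact (m - i)) (g $ (m - i)))) =
    smult (fact m) ((f * g) $ m)"
proof -
  have "of_nat (m choose i) * (smult (fact i) (f $ i) * smult (fact (m - i)) (g $ (m - i))) =
      smult (fact m) (f $ i * g $ (m - i))" if "i \<le> m" for i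
  proof -
    have "of_nat (m choose i) * (smult (fact i) (f $ i) * smult (fact (m - i)) (g $ (m - i))) =
        smult (of_nat (m choose i) * (fact i * fact (m - i))) (f $ i * g $ (m - i))"
      by (simp add: of_nat_poly mult_ac)
    then show ?thesis
      using binomial_fact_lemma[OF that, THEN arg_cong[of _ _ "of_nat :: nat \<Rightarrow> complex"]]
      by (simp add: mult_ac)
  qed
  then show ?thesis
    by (simp add: fps_mult_nth smult_sum_right atMost_atLeast0)
qed

lemma lt_mult_diagonal_conjugate:
  fixes M N :: "nat \<Rightarrow> nat \<Rightarrow> complex poly" and d :: "nat \<Rightarrow> complex"
  assumes "\<And>n. d n \<noteq> 0"
  shows "lt_mult (\<lambda>n k. smult (d n / d k) (M n k)) (\<lambda>n k. smult (d n / d k) (N n k)) =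
    (\<lambda>n k. smult (d n / d k) (lt_mult M N n k))"
  using assms by (simp add: lt_mult_def fun_eq_iff smult_sum_right)

lemma lt_one_diagonal_conjugate:
  fixes d :: "nat \<Rightarrow> complex"
  assumes "\<And>n. d n \<noteq> 0"
  shows "(\<lambda>n k. smult (d n / d k) (lt_one n k)) = lt_one"
  using assms by (simp add: lt_one_def fun_eq_iff)

section \<open>Moments and generating functions of umbrae\<close>

context saturated_umbral_calculus
begin

lemma E_zero: "E 0 = 0"
  using E_add[of 0 0] by simp

lemma E_sum: "E (\<Sum>i\<in>I. p i) = (\<Sum>i\<in>I. E (p i))"
  by (induction I rule: infinite_finite_induct) (simp_all add: E_zero E_add)

lemma E_of_nat_mult: "E (of_nat r * p) = of_nat r * E p"
  by (induction r) (simp_all add: E_zero E_add distrib_right)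

lemma E_mult_powers:
  assumes "\<beta> \<noteq> \<delta>"
  shows "E (umbra \<beta> ^ i * umbra \<delta> ^ j) = E (umbra \<beta> ^ i) * E (umbra \<delta> ^ j)"
  using E_uncorrelated[of "{\<beta>, \<delta>}" "\<lambda>x. if x = \<beta> then i else j"] assms by auto

text \<open>The case p = 0 serves the Riordan entries, p = 1 the moments of
  \<open>K_umbra\<close>.\<close>

lemma E_power_sum:
  assumes "\<beta> \<noteq> \<delta>"
  shows "E (umbra \<beta> ^ p * (umbra \<beta> + umbra \<delta>) ^ m) =
    (\<Sum>i\<le>m. of_nat (m choose i) * (E (umbra \<beta> ^ (p + i)) * E (umbra \<delta> ^ (m - i))))"
proof -
  have "umbra \<beta> ^ p * (umbra \<beta> + umbra \<delta>) ^ m =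
      (\<Sum>i\<le>m. of_nat (m choose i) * (umbra \<beta> ^ (p + i) * umbra \<delta> ^ (m - i)))"
    by (simp add: binomial_ring sum_distrib_left power_add mult_ac)
  then show ?thesis
    by (simp add: E_sum E_of_nat_mult E_mult_powers[OF assms])
qed

lemma E_umbra_power: "E (umbra \<beta> ^ n) = smult (fact n) (umbral_gf E \<beta> $ n)"
  by (simp add: umbral_gf_def)

lemma umbral_gf_0: "umbral_gf E \<beta> $ 0 = 1"
  using fps_int_power_umbral_gf_0[of \<beta> 1] by (simp add: fps_int_power_def)

lemma umbral_gf_right_inverse: "umbral_gf E \<beta> * fps_right_inverse (umbral_gf E \<beta>) 1 = 1"
  by (rule fps_right_inverse) (simp add: umbral_gf_0)

lemma umbral_gf_dot_umbra:
  "finite S \<Longrightarrow> umbral_gf E (dot_umbra E S x \<beta>) = fps_int_power (umbral_gf E \<beta>) x"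
  by (rule fps_ext) (simp add: umbral_gf_def dot_umbra(2))

section \<open>Riordan arrays as coefficient arrays\<close>

lemma omega_riordan_eq_coeff:
  "omega_riordan E c \<beta> \<delta> n k =
    smult (c n / c k) ((umbral_gf E \<beta> * (fps_X * umbral_gf E \<delta>) ^ k) $ n)"
proof -
  let ?\<eta> = "dot_umbra E {\<beta>} (int k) \<delta>"
  have gf: "umbral_gf E ?\<eta> = umbral_gf E \<delta> ^ k"
    by (simp add: umbral_gf_dot_umbra fps_int_power_def)
  have "umbral_gf E \<beta> * (fps_X * umbral_gf E \<delta>) ^ k =
      fps_X ^ k * (umbral_gf E \<beta> * umbral_gf E ?\<eta>)"
    by (simp add: gf power_mult_distrib mult_ac)
  then have shift: "(umbral_gf E \<beta> * (fps_X * umbral_gf E \<delta>) ^ k) $ n =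
      (if n < k then 0 else (umbral_gf E \<beta> * umbral_gf E ?\<eta>) $ (n - k))"
    by (simp only: fps_X_power_mult_nth)
  \<comment> \<open>The dot umbra avoids \<beta>, so the two are uncorrelated and their generating
    functions multiply.\<close>
  have "\<beta> \<noteq> ?\<eta>"
    using dot_umbra(1)[of "{\<beta>}" "int k" \<delta>] by auto
  then have "E ((umbra \<beta> + umbra ?\<eta>) ^ (n - k)) =
      smult (fact (n - k)) ((umbral_gf E \<beta> * umbral_gf E ?\<eta>) $ (n - k))"
    using E_power_sum[of \<beta> ?\<eta> 0 "n - k"]
    by (simp only: E_umbra_power sum_binomial_fact_convolution power_0 mult_1 add_0 not_False_eq_True)
  then show ?thesis
    unfolding shift by (simp add: omega_riordan_def E_scal)
qed

lemma omega_riordan_cong: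
  assumes "umbral_gf E \<beta> = umbral_gf E \<beta>'" and "umbral_gf E \<delta> = umbral_gf E \<delta>'"
  shows "omega_riordan E c \<beta> \<delta> = omega_riordan E c \<beta>' \<delta>'"
  by (simp add: fun_eq_iff omega_riordan_eq_coeff assms)

lemma omega_riordan_conjugate_exp_riordan:
  "omega_riordan E c \<beta> \<delta> =
    (\<lambda>n k. smult ((c n / fact n) / (c k / fact k)) (exp_riordan E \<beta> \<delta> n k))"
  by (simp add: fun_eq_iff exp_riordan_def omega_riordan_eq_coeff)

text \<open>The fundamental property of Riordan arrays: a column with generating function h is sent
  to g (h o F).\<close>

lemma lt_mult_exp_riordan_coeff:
  "lt_mult (exp_riordan E \<gamma> \<alpha>) (exp_riordan E \<beta> \<delta>) n k =
    smult (fact n / fact k)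
      ((((umbral_gf E \<beta> * (fps_X * umbral_gf E \<delta>) ^ k) oo (fps_X * umbral_gf E \<alpha>))
        * umbral_gf E \<gamma>) $ n)"
  by (subst fps_compose_mult_nth)
    (simp_all add: lt_mult_def exp_riordan_def omega_riordan_eq_coeff smult_sum_right mult_ac)

section \<open>The K and L umbrae and inverse arrays\<close>

lemma umbral_gf_K_umbra_coeff:
  assumes "n \<ge> 1"
  shows "of_nat n * umbral_gf E (K_umbra E \<beta> \<alpha>) $ n =
    (fps_deriv (umbral_gf E \<beta>) * fps_right_inverse (umbral_gf E \<alpha>) 1 ^ n) $ (n - 1)"
proof -
  let ?\<eta> = "dot_umbra E {\<beta>} (- int n) \<alpha>"
  obtain m where n: "n = Suc m"
    using assms by (cases n) auto
  have "\<beta> \<noteq> ?\<eta>"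
    using dot_umbra(1)[of "{\<beta>}" "- int n" \<alpha>] by auto
  have gf: "umbral_gf E ?\<eta> = fps_right_inverse (umbral_gf E \<alpha>) 1 ^ n"
    using assms by (simp add: umbral_gf_dot_umbra fps_int_power_def)
  \<comment> \<open>The separate factor \<beta> raises each exponent by one, which replaces its
    generating function by the derivative.\<close>
  have deriv: "smult (fact (Suc i)) (umbral_gf E \<beta> $ Suc i) =
      smult (fact i) (fps_deriv (umbral_gf E \<beta>) $ i)" for i
    by (simp add: of_nat_poly algebra_simps smult_add_left smult_add_right)
  have "smult (fact n) (umbral_gf E (K_umbra E \<beta> \<alpha>) $ n) =
      E (umbra \<beta> ^ 1 * (umbra \<beta> + umbra ?\<eta>) ^ m)"
    using K_umbra[OF assms, of \<beta> \<alpha>]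
    by (simp only: E_umbra_power[symmetric] power_one_right) (simp add: n)
  also have "\<dots> = smult (fact m) ((fps_deriv (umbral_gf E \<beta>) * umbral_gf E ?\<eta>) $ m)"
    unfolding E_power_sum[OF \<open>\<beta> \<noteq> ?\<eta>\<close>] E_umbra_power plus_1_eq_Suc deriv
    by (rule sum_binomial_fact_convolution)
  finally have "smult (fact m) (of_nat n * umbral_gf E (K_umbra E \<beta> \<alpha>) $ n) =
      smult (fact m) ((fps_deriv (umbral_gf E \<beta>) * umbral_gf E ?\<eta>) $ m)"
    by (simp add: n of_nat_poly algebra_simps smult_add_left smult_add_right)
  then have "of_nat n * umbral_gf E (K_umbra E \<beta> \<alpha>) $ n =
      (fps_deriv (umbral_gf E \<beta>) * umbral_gf E ?\<eta>) $ m"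
    by (metis fact_nonzero smult_cancel)
  then show ?thesis
    by (simp only: gf) (simp add: n)
qed

lemma umbral_gf_K_umbra:
  assumes "umbral_gf E \<beta> = k oo (fps_X * umbral_gf E \<alpha>)"
  shows "umbral_gf E (K_umbra E \<beta> \<alpha>) = k"
proof (rule fps_ext)
  fix n
  show "umbral_gf E (K_umbra E \<beta> \<alpha>) $ n = k $ n"
  proof (cases "n = 0")
    \<comment> \<open>Lagrange inversion starts at n = 1; the constant term of k is 1 because F has
      constant term 0.\<close>
    case True
    then show ?thesis
      using arg_cong[OF assms, of "\<lambda>f. f $ 0"] by (simp add: umbral_gf_0)
  next
    case False
    then have "of_nat n * umbral_gf E (K_umbra E \<beta> \<alpha>) $ n = of_nat n * k $ n"
      by (subst umbral_gf_K_umbra_coeff)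
        (simp_all only: assms fps_lagrange_inversion[OF umbral_gf_right_inverse])
    then show ?thesis
      using False by simp
  qed
qed

text \<open>Composition with F is multiplicative, so \<beta> has generating function (1/d) o F,
  where d is that of \<delta>. The K umbra then has 1/d, and the outer dot operation with -1 returns
  d.\<close>

lemma umbral_gf_L_umbra:
  assumes "umbral_gf E \<beta> * (umbral_gf E \<delta> oo (fps_X * umbral_gf E \<alpha>)) = 1"
  shows "umbral_gf E (L_umbra E \<beta> \<alpha>) = umbral_gf E \<delta>"
proof -
  let ?F = "fps_X * umbral_gf E \<alpha>"
  define k where "k = fps_right_inverse (umbral_gf E \<delta>) 1"
  have k: "umbral_gf E \<delta> * k = 1"
    by (simp add: k_def umbral_gf_right_inverse)
  have "(umbral_gf E \<delta> oo ?F) * (k oo ?F) = 1"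
    by (simp add: k flip: fps_compose_mult_distrib)
  with assms have "umbral_gf E \<beta> = k oo ?F"
    by (rule left_inverse_eq_right_inverse)
  then have "umbral_gf E (K_umbra E \<beta> \<alpha>) = k"
    by (rule umbral_gf_K_umbra)
  then have L: "umbral_gf E (L_umbra E \<beta> \<alpha>) = fps_right_inverse k 1"
    and inv: "k * fps_right_inverse k 1 = 1"
    using umbral_gf_right_inverse[of "K_umbra E \<beta> \<alpha>"]
    by (simp_all add: L_umbra_def umbral_gf_dot_umbra fps_int_power_def)
  show ?thesis
    unfolding L by (rule left_inverse_eq_right_inverse[OF k inv, symmetric])
qed

lemma exp_riordan_inverse_gf:
  assumes "lt_mult (exp_riordan E \<gamma> \<alpha>) (exp_riordan E \<beta> \<delta>) = lt_one"
  shows "umbral_gf E \<gamma> * (umbral_gf E \<beta> oo (fps_X * umbral_gf E \<alpha>)) = 1"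
    and "umbral_gf E \<alpha> * (umbral_gf E \<delta> oo (fps_X * umbral_gf E \<alpha>)) = 1"
proof -
  let ?F = "fps_X * umbral_gf E \<alpha>"
  have column: "((umbral_gf E \<beta> * (fps_X * umbral_gf E \<delta>) ^ k) oo ?F) * umbral_gf E \<gamma> = fps_X ^ k" for k
  proof (rule fps_ext)
    fix n
    let ?x = "(((umbral_gf E \<beta> * (fps_X * umbral_gf E \<delta>) ^ k) oo ?F) * umbral_gf E \<gamma>) $ n"
    have *: "smult (fact n / fact k) ?x = lt_one n k"
      using assms by (metis lt_mult_exp_riordan_coeff)
    show "?x = fps_X ^ k $ n"
      using * by (cases "n = k") (simp_all add: lt_one_def)
  qed
  from column[of 0] show 0: "umbral_gf E \<gamma> * (umbral_gf E \<beta> oo ?F) = 1"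
    by (simp add: mult.commute)
  \<comment> \<open>Column 1 contains the product from column 0 as a factor 1; what remains is X
    times the claim.\<close>
  have "fps_X = (umbral_gf E \<gamma> * (umbral_gf E \<beta> oo ?F)) * (?F * (umbral_gf E \<delta> oo ?F))"
    using column[of 1] by (simp add: fps_compose_mult_distrib mult_ac)
  then have "fps_X * (umbral_gf E \<alpha> * (umbral_gf E \<delta> oo ?F)) = fps_X * 1"
    by (simp add: 0 mult.assoc)
  then show "umbral_gf E \<alpha> * (umbral_gf E \<delta> oo ?F) = 1"
    by (subst (asm) mult_cancel_left) simp
qed

end

theorem theorem3p3:
  fixes E :: "'a umbral_poly \<Rightarrow> complex poly"
    and c :: "nat \<Rightarrow> complex"
    and \<omega> \<gamma> \<alpha> \<sigma> \<rho> :: 'a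
  assumes "saturated_umbral_calculus E"
    and "\<And>n. c n \<noteq> 0"
    and "c 0 = 1"
    and "\<And>n. E (umbra \<omega> ^ n) = [:fact n / c n:]"
  shows "(\<forall>\<gamma>' \<alpha>'.
            lt_mult (exp_riordan E \<gamma> \<alpha>) (exp_riordan E \<sigma> \<rho>) = exp_riordan E \<gamma>' \<alpha>' \<longrightarrow>
            lt_mult (omega_riordan E c \<gamma> \<alpha>) (omega_riordan E c \<sigma> \<rho>) = omega_riordan E c \<gamma>' \<alpha>')
       \<and> (\<forall>\<gamma>'' \<alpha>''.
            is_lt_inverse (exp_riordan E \<gamma> \<alpha>) (exp_riordan E \<gamma>'' \<alpha>'') \<longrightarrow>
            is_lt_inverse (omega_riordan E c \<gamma> \<alpha>) (omega_riordan E c \<gamma>'' \<alpha>'') \<and>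
            omega_riordan E c \<gamma>'' \<alpha>'' = omega_riordan E c (L_umbra E \<gamma> \<alpha>) (L_umbra E \<alpha> \<alpha>))"
proof -
  interpret saturated_umbral_calculus E by fact
  have d: "c n / fact n \<noteq> 0" for n
    using assms(2) by simp
  have mult: "lt_mult (omega_riordan E c \<beta> \<delta>) (omega_riordan E c \<beta>' \<delta>') =
      (\<lambda>n k. smult ((c n / fact n) / (c k / fact k))
        (lt_mult (exp_riordan E \<beta> \<delta>) (exp_riordan E \<beta>' \<delta>') n k))" for \<beta> \<delta> \<beta>' \<delta>'
    unfolding omega_riordan_conjugate_exp_riordan[of c]
    by (rule lt_mult_diagonal_conjugate[OF d])
  have "omega_riordan E c \<gamma>'' \<alpha>'' = omega_riordan E c (L_umbra E \<gamma> \<alpha>) (L_umbra E \<alpha> \<alpha>)"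
    if "is_lt_inverse (exp_riordan E \<gamma> \<alpha>) (exp_riordan E \<gamma>'' \<alpha>'')" for \<gamma>'' \<alpha>''
  proof (rule omega_riordan_cong)
    have "lt_mult (exp_riordan E \<gamma> \<alpha>) (exp_riordan E \<gamma>'' \<alpha>'') = lt_one"
      using that by (simp add: is_lt_inverse_def)
    \<comment> \<open>The second identity is the case \<beta> = \<alpha> of
      \<open>umbral_gf_L_umbra\<close>, whence \<open>L_umbra E \<alpha> \<alpha>\<close>.\<close>
    from exp_riordan_inverse_gf[OF this]
    show "umbral_gf E \<gamma>'' = umbral_gf E (L_umbra E \<gamma> \<alpha>)"
      and "umbral_gf E \<alpha>'' = umbral_gf E (L_umbra E \<alpha> \<alpha>)"
      by (simp_all add: umbral_gf_L_umbra)
  qed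
  moreover have "is_lt_inverse (omega_riordan E c \<gamma> \<alpha>) (omega_riordan E c \<gamma>'' \<alpha>'')"
    if "is_lt_inverse (exp_riordan E \<gamma> \<alpha>) (exp_riordan E \<gamma>'' \<alpha>'')" for \<gamma>'' \<alpha>''
    using that lt_one_diagonal_conjugate[OF d]
    by (simp only: is_lt_inverse_def mult lower_triangular_omega_riordan simp_thms)
  moreover have "lt_mult (omega_riordan E c \<gamma> \<alpha>) (omega_riordan E c \<sigma> \<rho>) = omega_riordan E c \<gamma>' \<alpha>'"
    if "lt_mult (exp_riordan E \<gamma> \<alpha>) (exp_riordan E \<sigma> \<rho>) = exp_riordan E \<gamma>' \<alpha>'" for \<gamma>' \<alpha>'
    by (simp only: mult that omega_riordan_conjugate_exp_riordan[of c \<gamma>' \<alpha>'])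
  ultimately show ?thesis
    by blast
qed

end
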